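(* Let $K$ clients hold local SAFLe feature matrices $\Phi_k\in\mathbb{R}^{N_k\times D_e}$ and local one-hot label matrices $Y_k\in\mathbb{R}^{N_k\times C}$, $k=1,\dots,K$, as described in the context. Let $\Phi$ and $Y$ be the vertical stacks of $\Phi_1,\dots,\Phi_K$ and of $Y_1,\dots,Y_K$, and let the global model be $$W_{global}=(\Phi^T\Phi)^\dagger(\Phi^TY)\in\mathbb{R}^{D_e\times C},$$ the solution given by the normal equations to the problem of minimizing $\sum_{k=1}^K\|Y_k-\Phi_kW\|_F^2=\|Y-\Phi W\|_F^2$ over $W\in\mathbb{R}^{D_e\times C}$. Then, by extending the RI-AA law of Analytic Federated Learning (described in the context), the global model $W_{global}$ can be solved analytically in a single communication round.
   Context: $A^\dagger$ denotes the Moore–Penrose pseudoinverse of $A$ and $\|\cdot\|_F$ the Frobenius norm. "Solved analytically" means obtained by a closed-form (gradient-free, non-iterative) formula. "In a single communication round" means that each client transmits once to the server quantities computed from its own local data, and the server then computes the result from what it has received. RI-AA law: in Analytic Federated Learning (AFL), each client $k$ has a feature matrix $X_k$ and label matrix $Y_k$ and solves the local least-squares problem $\min_{W_k}\|Y_k-X_kW_k\|_F^2$. The Absolute Aggregation (AA) law is an exact closed-form formula by which the server reconstructs, in a single round, the model that would have been trained on all the data at once, as a combination of the local models with weighting matrices computed from the clients' covariance matrices $X_k^TX_k$. The Regularization Intermediary (RI) process, used to handle rank-deficient data, adds regularization to the local problems and then analytically removes it at the server, preserving the exact solution. SAFLe feature matrices: fix positive integers $d_b, L, q, E, G$ with $EG=d_bL$,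 put $V=q^G$ and $D_e=EV$, and fix bucketing functions $B_1,\dots,B_L:\mathbb{R}\to\{0,\dots,q-1\}$ and a fixed permutation $P$ of $d_bL$ coordinates. For $x\in\mathbb{R}^{d_b}$ form $b=[B_1(x_1),\dots,B_L(x_1),\dots,B_1(x_{d_b}),\dots,B_L(x_{d_b})]$, permute its coordinates by $P$, and partition the result into $E$ groups $g_j=[g_{j,1},\dots,g_{j,G}]$, $j=1,\dots,E$. Put $idx_j(x)=\sum_{i=1}^G g_{j,i}\,q^{i-1}\in\{0,\dots,V-1\}$, let $\phi_j(x)\in\{0,1\}^V$ be the one-hot vector whose only nonzero entry is at position $idx_j(x)$ (positions indexed by $0,\dots,V-1$), and let $\Phi(x)\in\mathbb{R}^{D_e}$ be the concatenation of $\phi_1(x),\dots,\phi_E(x)$. Client $k$ holds $N_k$ data vectors in $\mathbb{R}^{d_b}$; the $i$-th row of $\Phi_k$ is $\Phi(x)^T$ for its $i$-th data vector $x$, and the $i$-th row of $Y_k$ is the one-hot label vector (with $C$ classes) of that data vector. The SAFLe model with embedding matrices $W_1,\dots,W_E\in\mathbb{R}^{V\times C}$ outputs $\sum_{j=1}^E W_j[idx_j(x),:]=\Phi(x)^TW$, where $W\in\mathbb{R}^{D_e\times C}$ is the vertical stack of $W_1,\dots,W_E$ and $W_j[i,:]$ is the row of $W_j$ of index $i$; $W_{global}$ is such a stacked matrix. *)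

theory Defs
  imports
    "Jordan_Normal_Form.Gauss_Jordan_Elimination"
    "HOL-Combinatorics.Permutations"
begin

section \<open>Matrices\<close>

definition fro_norm :: "real mat \<Rightarrow> real" where
  "fro_norm A = sqrt (\<Sum>i<dim_row A. \<Sum>j<dim_col A. (A $$ (i, j))\<^sup>2)"

definition is_pinv :: "real mat \<Rightarrow> real mat \<Rightarrow> bool" where
  "is_pinv A X \<longleftrightarrow> X \<in> carrier_mat (dim_col A) (dim_row A) \<and>
     A * X * A = A \<and> X * A * X = X \<and>
     transpose_mat (A * X) = A * X \<and> transpose_mat (X * A) = X * A"

definition pinv :: "real mat \<Rightarrow> real mat" where
  "pinv A = (THE X. is_pinv A X)"

text \<open>Unspecified if the matrix is singular; used below only for positive definite matrices.\<close>
definition mat_inv :: "real mat \<Rightarrow> real mat" where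
  "mat_inv A = the (mat_inverse A)"

text \<open>The dimensions are given explicitly, since matrices have no dimension-independent zero.\<close>
definition mat_sum :: "nat \<Rightarrow> nat \<Rightarrow> real mat list \<Rightarrow> real mat" where
  "mat_sum nr nc As = foldr (+) As (0\<^sub>m nr nc)"

definition vstack :: "nat \<Rightarrow> real mat list \<Rightarrow> real mat" where
  "vstack nc As = mat_of_rows nc (concat (map rows As))"


section \<open>SAFLe features\<close>

text \<open>Coordinates, bucketing functions, groups and table positions are numbered from 0.
  Here \<open>B l\<close> is the bucketing function of index \<open>l < L\<close>, and coordinate \<open>m\<close> of the permuted
  vector is coordinate \<open>P m\<close> of the original one.\<close>

definition bucket_list :: "nat \<Rightarrow> (nat \<Rightarrow> real \<Rightarrow> nat) \<Rightarrow> real vec \<Rightarrow> nat list" where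
  "bucket_list L B x = concat (map (\<lambda>i. map (\<lambda>l. B l (x $ i)) [0..<L]) [0..<dim_vec x])"

definition table_index ::
  "nat \<Rightarrow> nat \<Rightarrow> nat \<Rightarrow> (nat \<Rightarrow> real \<Rightarrow> nat) \<Rightarrow> (nat \<Rightarrow> nat) \<Rightarrow> nat \<Rightarrow> real vec \<Rightarrow> nat" where
  "table_index L q G B P j x =
     (\<Sum>i<G. permute_list P (bucket_list L B x) ! (j * G + i) * q ^ i)"

definition feature_vec ::
  "nat \<Rightarrow> nat \<Rightarrow> nat \<Rightarrow> nat \<Rightarrow> (nat \<Rightarrow> real \<Rightarrow> nat) \<Rightarrow> (nat \<Rightarrow> nat) \<Rightarrow> real vec \<Rightarrow> real vec" where
  "feature_vec L q E G B P x =
     vec_of_list (concat (map (\<lambda>j. list_of_vec (unit_vec (q ^ G) (table_index L q G B P j x))) [0..<E]))"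

definition feature_matrix ::
  "nat \<Rightarrow> nat \<Rightarrow> nat \<Rightarrow> nat \<Rightarrow> (nat \<Rightarrow> real \<Rightarrow> nat) \<Rightarrow> (nat \<Rightarrow> nat) \<Rightarrow> real vec list \<Rightarrow> real mat" where
  "feature_matrix L q E G B P xs = mat_of_rows (E * q ^ G) (map (feature_vec L q E G B P) xs)"

definition label_matrix :: "nat \<Rightarrow> nat list \<Rightarrow> real mat" where
  "label_matrix C cs = mat_of_rows C (map (unit_vec C) cs)"


section \<open>Single-round RI-AA aggregation\<close>

text \<open>Each client applies \<open>client\<close> to its own data only and transmits the result once; the server
  sees nothing but the list of these messages.\<close>
definition single_round :: "('d \<Rightarrow> 'm) \<Rightarrow> ('m list \<Rightarrow> 'r) \<Rightarrow> 'd list \<Rightarrow> 'r" where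
  "single_round client server ds = server (map client ds)"

definition reg_cov :: "real \<Rightarrow> real mat \<Rightarrow> real mat" where
  "reg_cov \<gamma> X = transpose_mat X * X + \<gamma> \<cdot>\<^sub>m 1\<^sub>m (dim_col X)"

definition local_model :: "real \<Rightarrow> real mat \<Rightarrow> real mat \<Rightarrow> real mat" where
  "local_model \<gamma> X Y = mat_inv (reg_cov \<gamma> X) * (transpose_mat X * Y)"

definition client_message :: "real \<Rightarrow> real mat \<times> real mat \<Rightarrow> real mat \<times> real mat" where
  "client_message \<gamma> = (\<lambda>(X, Y). (reg_cov \<gamma> X, local_model \<gamma> X Y))"

text \<open>Messages are pairs of a regularized covariance \<open>S\<^sub>k\<close> and a local model \<open>W\<^sub>k\<close>. The weight of
  \<open>W\<^sub>k\<close> is \<open>(\<Sum>\<^sub>i S\<^sub>i)\<^sup>-\<^sup>1 S\<^sub>k\<close>. For two clients this is the same matrix as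
  \<open>I - S\<^sub>1\<^sup>-\<^sup>1 S\<^sub>2 + S\<^sub>1\<^sup>-\<^sup>1 S\<^sub>2 (S\<^sub>1 + S\<^sub>2)\<^sup>-\<^sup>1 S\<^sub>2\<close>, the weight of \<open>W\<^sub>1\<close> in the pairwise form
  of the AA law.\<close>
definition aa_aggregate :: "nat \<Rightarrow> nat \<Rightarrow> (real mat \<times> real mat) list \<Rightarrow> real mat" where
  "aa_aggregate n c msgs =
     mat_sum n c (map (\<lambda>(S, W). mat_inv (mat_sum n n (map fst msgs)) * S * W) msgs)"

text \<open>Removes the total regularization \<open>K\<gamma>I\<close> of \<open>K\<close> clients. The pseudoinverse takes the place of
  the inverse in the full-rank case.\<close>
definition ri_remove :: "real \<Rightarrow> nat \<Rightarrow> (real mat \<times> real mat) list \<Rightarrow> real mat \<Rightarrow> real mat" where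
  "ri_remove \<gamma> n msgs W =
     (let S = mat_sum n n (map fst msgs)
      in pinv (S - (real (length msgs) * \<gamma>) \<cdot>\<^sub>m 1\<^sub>m n) * (S * W))"

definition ri_aa_server :: "real \<Rightarrow> nat \<Rightarrow> nat \<Rightarrow> (real mat \<times> real mat) list \<Rightarrow> real mat" where
  "ri_aa_server \<gamma> n c msgs = ri_remove \<gamma> n msgs (aa_aggregate n c msgs)"

end

theory Submission
  imports Defs "HOL-Library.Function_Algebras" "Jordan_Normal_Form.Determinant"
begin

text \<open>A local model satisfies \<open>S\<^sub>k W\<^sub>k = X\<^sub>k\<^sup>T Y\<^sub>k\<close>, so covariance-weighted aggregation only ever
  sees the sums of the Gram matrices and of the cross terms, which are additive over row blocks.
  The server therefore knows \<open>\<Phi>\<^sup>T \<Phi> + K\<gamma>I\<close> and \<open>\<Phi>\<^sup>T Y\<close> exactly, subtracts \<open>K\<gamma>I\<close> and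
  applies the pseudoinverse; optimality follows by completing the square.\<close>

section \<open>The pseudoinverse\<close>

text \<open>Side conditions are equations between dimensions instead of carrier memberships, so that
  simplification can discharge them and reassociate long products freely.\<close>

lemma mat_mult_assoc_dim:
  fixes A B C :: "real mat"
  assumes "dim_col A = dim_row B" "dim_col B = dim_row C"
  shows "A * B * C = A * (B * C)"
  using assms by (intro assoc_mult_mat[of _ "dim_row A" "dim_row B" _ "dim_row C" _ "dim_col C"]) auto

lemma transpose_mult_dim:
  fixes A B :: "real mat"
  assumes "dim_col A = dim_row B"
  shows "transpose_mat (A * B) = transpose_mat B * transpose_mat A"
  using assms by (intro transpose_mult[of _ "dim_row A" "dim_row B" _ "dim_col B"]) auto

lemma mat_mult_minus_dim:
  fixes A B C :: "real mat"
  assumes "dim_col A = dim_row B" "dim_row C = dim_row B" "dim_col C = dim_col B"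
  shows "A * (B - C) = A * B - A * C"
  using assms
  by (intro mult_minus_distrib_mat[of _ "dim_row A" "dim_row B" _ "dim_col B"] carrier_matI) auto

lemma mat_minus_eq_0_iff:
  fixes A B :: "real mat"
  assumes "dim_row A = dim_row B" "dim_col A = dim_col B"
  shows "A - B = 0\<^sub>m (dim_row B) (dim_col B) \<longleftrightarrow> A = B"
proof
  assume *: "A - B = 0\<^sub>m (dim_row B) (dim_col B)"
  show "A = B"
  proof (rule eq_matI)
    fix i j assume "i < dim_row B" "j < dim_col B"
    then have "(A - B) $$ (i, j) = 0" unfolding * by simp
    then show "A $$ (i, j) = B $$ (i, j)" using \<open>i < dim_row B\<close> \<open>j < dim_col B\<close> by simp
  qed (use assms in auto)
qed (use assms in \<open>auto intro!: eq_matI\<close>)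

section \<open>Inner inverses of real matrices\<close>

lemma sum_fun_apply: "(\<Sum>x\<in>S. f x) y = (\<Sum>x\<in>S. f x y :: 'a :: comm_monoid_add)"
  by (induction S rule: infinite_finite_induct) auto

text \<open>A linear map has a linear right inverse on its range. Applied to multiplication by
  \<open>A\<close>, this gives a linear \<open>g\<close> with \<open>f (g (f v)) = f v\<close>, and
  \<open>G\<close> is its matrix.\<close>

lemma inner_inverse_exists:
  fixes A :: "real mat"
  shows "\<exists>G \<in> carrier_mat (dim_col A) (dim_row A). A * G * A = A"
proof -
  let ?s = "\<lambda>(c :: real) (v :: nat \<Rightarrow> real) i. c * v i"
  \<comment> \<open>Vectors are modelled as infinite sequences, a real vector space under pointwise
    operations. Cutting \<open>f\<close> off beyond \<open>dim_row A\<close> makes each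
    \<open>f (e k)\<close> a finite combination of unit sequences, so linearity of \<open>g\<close>
    yields the finite sums of a matrix product.\<close>
  define f where "f v = (\<lambda>i. if i < dim_row A then \<Sum>j<dim_col A. A $$ (i, j) * v j else 0)"
    for v :: "nat \<Rightarrow> real"
  define e where "e k = (\<lambda>i :: nat. if i = k then 1 else 0 :: real)" for k
  have vs: "vector_space ?s"
    by unfold_locales (auto simp: fun_eq_iff algebra_simps)
  then interpret vector_space_pair ?s ?s
    by (simp add: vector_space_pair_def)
  have "Vector_Spaces.linear ?s ?s f"
    by (auto simp: Vector_Spaces.linear_iff vs f_def fun_eq_iff algebra_simps sum.distrib sum_distrib_left)
  then obtain g where g: "Vector_Spaces.linear ?s ?s g" and fgf: "\<And>v. f (g (f v)) = f v"
    using linear_exists_right_inverse_on[OF _ vs1.subspace_UNIV] by blast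
  \<comment> \<open>Truncating \<open>g (e j)\<close> to its first \<open>dim_col A\<close>
    coordinates loses nothing, since \<open>f\<close> reads no others.\<close>
  define G where "G = mat (dim_col A) (dim_row A) (\<lambda>(i, j). g (e j) i)"
  have dims: "G \<in> carrier_mat (dim_col A) (dim_row A)" by (simp add: G_def)
  have fe: "f (e k) = (\<Sum>j<dim_row A. ?s (A $$ (j, k)) (e j))" if "k < dim_col A" for k
    using that by (auto simp: fun_eq_iff f_def e_def sum_fun_apply if_distrib cong: if_cong)
  have gf: "g (f (e k)) = (\<Sum>j<dim_row A. ?s (A $$ (j, k)) (g (e j)))" if "k < dim_col A" for k
    unfolding fe[OF that] linear_sum[OF g] linear_scale[OF g] ..
  have GA: "(G * A) $$ (i, k) = g (f (e k)) i" if "i < dim_col A" "k < dim_col A" for i k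
    using that by (simp add: G_def gf scalar_prod_def sum_fun_apply mult.commute atLeast0LessThan)
  have "A * (G * A) = A"
  proof (rule eq_matI)
    fix i k assume ik: "i < dim_row A" "k < dim_col A"
    have "(A * (G * A)) $$ (i, k) = (\<Sum>j<dim_col A. A $$ (i, j) * (G * A) $$ (j, k))"
      using ik dims
      by (subst index_mult_mat(1)) (auto simp: scalar_prod_def atLeast0LessThan simp del: index_mult_mat(1))
    also have "\<dots> = f (g (f (e k))) i" using ik by (simp add: GA f_def)
    also have "\<dots> = f (e k) i" by (simp only: fgf)
    also have "\<dots> = A $$ (i, k)" using ik by (simp add: f_def e_def if_distrib cong: if_cong)
    finally show "(A * (G * A)) $$ (i, k) = A $$ (i, k)" .
  qed (use dims in auto)
  then have "A * G * A = A" using dims by (subst mat_mult_assoc_dim) auto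
  with dims show ?thesis by blast
qed

section \<open>Cancellation of Gram factors\<close>

text \<open>Diagonal entry \<open>j\<close> of the Gram matrix is the sum of squares of column
  \<open>j\<close>.\<close>

lemma transpose_mult_self_eq_0:
  fixes A :: "real mat"
  assumes "transpose_mat A * A = 0\<^sub>m (dim_col A) (dim_col A)"
  shows "A = 0\<^sub>m (dim_row A) (dim_col A)"
proof (rule eq_matI)
  fix i j assume "i < dim_row (0\<^sub>m (dim_row A) (dim_col A))" "j < dim_col (0\<^sub>m (dim_row A) (dim_col A))"
  then have ij: "i < dim_row A" "j < dim_col A" by auto
  have "(transpose_mat A * A) $$ (j, j) = 0" unfolding assms using ij by simp
  then have "(\<Sum>k = 0..<dim_row A. A $$ (k, j) * A $$ (k, j)) = 0"
    using ij by (simp add: scalar_prod_def)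
  then show "A $$ (i, j) = 0\<^sub>m (dim_row A) (dim_col A) $$ (i, j)"
    using ij by (subst (asm) sum_nonneg_eq_0_iff) auto
qed auto

text \<open>\<open>A\<close> and its Gram matrix have the same kernel: for \<open>D = M - N\<close>,
  multiplying the hypothesis by the transpose of \<open>D\<close> shows that the Gram matrix of
  \<open>A * D\<close> vanishes.\<close>

lemma gram_cancel_left:
  fixes A M N :: "real mat"
  assumes "dim_row M = dim_col A" "dim_row N = dim_col A" "dim_col M = dim_col N"
    and eq: "transpose_mat A * A * M = transpose_mat A * A * N"
  shows "A * M = A * N"
proof -
  let ?D = "M - N"
  have "transpose_mat A * A * ?D = 0\<^sub>m (dim_col A) (dim_col N)"
    using assms mat_minus_eq_0_iff[of "transpose_mat A * A * M" "transpose_mat A * A * N"]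
    by (simp add: mat_mult_minus_dim)
  then have "transpose_mat ?D * (transpose_mat A * A * ?D) = 0\<^sub>m (dim_col N) (dim_col N)"
    using assms by simp
  then have "A * ?D = 0\<^sub>m (dim_row A) (dim_col N)"
    using assms transpose_mult_self_eq_0[of "A * ?D"]
    by (simp add: transpose_mult_dim mat_mult_assoc_dim)
  then show ?thesis
    using assms mat_minus_eq_0_iff[of "A * M" "A * N"] by (simp add: mat_mult_minus_dim)
qed

lemma gram_cancel_right:
  fixes A M N :: "real mat"
  assumes "dim_col M = dim_row A" "dim_col N = dim_row A" "dim_row M = dim_row N"
    and "M * (A * transpose_mat A) = N * (A * transpose_mat A)"
  shows "M * A = N * A"
proof -
  have tr: "transpose_mat (M * (A * transpose_mat A)) = A * transpose_mat A * transpose_mat M"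
    if "dim_col M = dim_row A" for M
    using that by (simp add: transpose_mult_dim)
  have "transpose_mat (transpose_mat A) * transpose_mat A * transpose_mat M
      = transpose_mat (transpose_mat A) * transpose_mat A * transpose_mat N"
    using tr[OF assms(1)] tr[OF assms(2)] assms(4) by simp
  then have "transpose_mat A * transpose_mat M = transpose_mat A * transpose_mat N"
    by (rule gram_cancel_left[rotated 3]) (simp_all add: assms)
  then have "transpose_mat (M * A) = transpose_mat (N * A)"
    using assms by (simp add: transpose_mult_dim)
  then show ?thesis by (metis transpose_transpose)
qed

section \<open>Uniqueness and existence of the pseudoinverse\<close>

text \<open>\<open>A * X\<close> and \<open>A * Y\<close> are symmetric and each absorbs the other
  on one side, so transposing their product identifies them; likewise \<open>X * A\<close> and
  \<open>Y * A\<close>. Then \<open>X = X * A * X = X * A * Y = Y * A * Y = Y\<close>.\<close>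

lemma is_pinv_unique:
  assumes X: "is_pinv A X" and Y: "is_pinv A Y"
  shows "X = Y"
proof -
  note dims = X[unfolded is_pinv_def, THEN conjunct1] Y[unfolded is_pinv_def, THEN conjunct1]
  have [simp]: "dim_row X = dim_col A" "dim_col X = dim_row A" "dim_row Y = dim_col A" "dim_col Y = dim_row A"
    using dims by auto
  note p = X[unfolded is_pinv_def] Y[unfolded is_pinv_def]
  have "A * X = A * Y * A * X" using p by simp
  also have "\<dots> = (A * Y) * (A * X)" by (simp add: mat_mult_assoc_dim)
  also have "\<dots> = transpose_mat (A * Y) * transpose_mat (A * X)" using p by simp
  also have "\<dots> = transpose_mat (A * X * (A * Y))" by (rule transpose_mult_dim[symmetric]) simp
  also have "A * X * (A * Y) = A * X * A * Y" by (simp add: mat_mult_assoc_dim)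
  also have "\<dots> = A * Y" using p by simp
  finally have AX: "A * X = A * Y" using p by simp
  have "X * A = X * (A * Y * A)" using p by simp
  also have "\<dots> = (X * A) * (Y * A)" by (simp add: mat_mult_assoc_dim)
  also have "\<dots> = transpose_mat (X * A) * transpose_mat (Y * A)" using p by simp
  also have "\<dots> = transpose_mat (Y * A * (X * A))" by (rule transpose_mult_dim[symmetric]) simp
  also have "Y * A * (X * A) = Y * (A * X * A)" by (simp add: mat_mult_assoc_dim)
  also have "\<dots> = Y * A" using p by simp
  finally have XA: "X * A = Y * A" using p by simp
  have "X = X * A * X" using p by simp
  also have "\<dots> = X * (A * X)" by (simp add: mat_mult_assoc_dim)
  also have "\<dots> = X * A * Y" unfolding AX by (simp add: mat_mult_assoc_dim)
  also have "\<dots> = Y" unfolding XA using p by simp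
  finally show ?thesis .
qed

text \<open>Zlobec's formula: \<open>A\<^sup>T G A\<^sup>T\<close> is the pseudoinverse for every inner inverse \<open>G\<close> of
  \<open>A\<^sup>T A A\<^sup>T\<close>.\<close>
lemma is_pinv_exists: "\<exists>X. is_pinv A X"
proof -
  let ?T = "transpose_mat A"
  obtain G where G: "G \<in> carrier_mat (dim_row A) (dim_col A)"
    and inner: "(?T * A * ?T) * G * (?T * A * ?T) = ?T * A * ?T"
    using inner_inverse_exists[of "?T * A * ?T"] by auto
  define X where "X = ?T * G * ?T"
  have [simp]: "dim_row G = dim_row A" "dim_col G = dim_col A"
    "dim_row X = dim_col A" "dim_col X = dim_row A"
    using G by (auto simp: X_def)
  \<comment> \<open>The inner-inverse equation, regrouped around \<open>X\<close>. Two left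
    cancellations, first with \<open>A\<close> and then with \<open>?T\<close> as the Gram factor,
    reduce it to \<open>X * (A * ?T) = ?T\<close>.\<close>
  have "?T * A * (X * (A * ?T)) = ?T * A * ?T"
    using inner by (simp add: X_def mat_mult_assoc_dim)
  then have "A * (X * (A * ?T)) = A * ?T"
    by (rule gram_cancel_left[rotated 3]) simp_all
  then have "A * ?T * (G * (?T * (A * ?T))) = A * ?T * 1\<^sub>m (dim_row A)"
    by (simp add: X_def mat_mult_assoc_dim)
  then have "?T * (G * (?T * (A * ?T))) = ?T * 1\<^sub>m (dim_row A)"
    using gram_cancel_left[of "G * (?T * (A * ?T))" ?T "1\<^sub>m (dim_row A)"] by simp
  then have XAT: "X * (A * ?T) = ?T" by (simp add: X_def mat_mult_assoc_dim)
  \<comment> \<open>The same equation is now cancelled from the right, with \<open>A\<close> and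
    then with \<open>?T\<close>, to reach the mirror identity
    \<open>?T * (A * X) = ?T\<close>.\<close>
  have "?T * A * (X * (A * ?T)) = ?T * A * ?T" using XAT by simp
  then have "(?T * A * X) * (A * ?T) = ?T * (A * ?T)" by (simp add: mat_mult_assoc_dim)
  then have "(?T * A * X) * A = ?T * A" by (rule gram_cancel_right[rotated 3]) simp_all
  then have "(?T * A * ?T * G) * (?T * A) = 1\<^sub>m (dim_col A) * (?T * A)"
    by (simp add: X_def mat_mult_assoc_dim)
  then have "(?T * A * ?T * G) * ?T = 1\<^sub>m (dim_col A) * ?T"
    using gram_cancel_right[of "?T * A * ?T * G" ?T "1\<^sub>m (dim_col A)"] by simp
  then have TAX: "?T * (A * X) = ?T" by (simp add: X_def mat_mult_assoc_dim)
  \<comment> \<open>The left side is symmetric by its form, hence so is the right side, which makes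
    \<open>X * A\<close> symmetric. The argument for \<open>A * X\<close> below is the same.\<close>
  have XA: "X * A * transpose_mat (X * A) = transpose_mat (X * A)"
  proof -
    have "X * A * transpose_mat (X * A) = (X * (A * ?T)) * transpose_mat X"
      by (simp add: transpose_mult_dim mat_mult_assoc_dim)
    then show ?thesis unfolding XAT by (simp add: transpose_mult_dim)
  qed
  then have symXA: "transpose_mat (X * A) = X * A"
    by (metis transpose_transpose transpose_mult_dim index_transpose_mat(2,3))
  have AX: "transpose_mat (A * X) * (A * X) = transpose_mat (A * X)"
    using TAX by (simp add: transpose_mult_dim mat_mult_assoc_dim)
  then have symAX: "transpose_mat (A * X) = A * X"
    by (metis transpose_transpose transpose_mult_dim index_transpose_mat(2,3))
  have "A * X * A = transpose_mat (?T * (A * X))"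
    using symAX by (simp add: transpose_mult_dim)
  then have AXA: "A * X * A = A" by (simp add: TAX)
  have "X * A * X = (X * (A * ?T)) * (G * ?T)" by (simp add: X_def mat_mult_assoc_dim)
  also have "\<dots> = X" unfolding XAT by (simp add: X_def mat_mult_assoc_dim)
  finally have "is_pinv A X"
    using AXA symXA symAX by (auto simp: is_pinv_def)
  then show ?thesis ..
qed

lemma is_pinv_pinv: "is_pinv A (pinv A)"
  unfolding pinv_def using is_pinv_exists is_pinv_unique by (metis theI)

text \<open>For \<open>M = transpose_mat A * A\<close>, cancelling \<open>A\<close> on the right in
  \<open>M * pinv M * M = M\<close> leaves
  \<open>M * pinv M * transpose_mat A = transpose_mat A\<close>. So the normal equation holds for
  \<open>A\<close> of any rank.\<close>

lemma pinv_gram_normal_equation: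
  assumes "dim_row Y = dim_row A"
  shows "transpose_mat A * A * (pinv (transpose_mat A * A) * (transpose_mat A * Y))
    = transpose_mat A * Y"
proof -
  let ?T = "transpose_mat A" let ?X = "pinv (?T * A)"
  have p: "?X \<in> carrier_mat (dim_col A) (dim_col A)" "?T * A * ?X * (?T * A) = ?T * A"
    using is_pinv_pinv[of "?T * A"] by (auto simp: is_pinv_def)
  have [simp]: "dim_row ?X = dim_col A" "dim_col ?X = dim_col A" using p by auto
  have "?T * A * ?X * ?T = 1\<^sub>m (dim_col A) * ?T"
    using gram_cancel_right[of "?T * A * ?X" ?T "1\<^sub>m (dim_col A)"] p(2) by simp
  then have "?T * A * ?X * ?T * Y = ?T * Y" by simp
  then show ?thesis using assms by (simp add: mat_mult_assoc_dim)
qed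

section \<open>Regularized least squares\<close>

definition fro_inner :: "real mat \<Rightarrow> real mat \<Rightarrow> real" where
  "fro_inner A B = (\<Sum>i<dim_row A. \<Sum>j<dim_col A. A $$ (i, j) * B $$ (i, j))"

lemma fro_norm_square: "(fro_norm A)\<^sup>2 = fro_inner A A"
  by (simp add: fro_norm_def fro_inner_def sum_nonneg power2_eq_square)

lemma fro_norm_square_eq_0:
  assumes "(fro_norm A)\<^sup>2 = 0"
  shows "A = 0\<^sub>m (dim_row A) (dim_col A)"
proof (rule eq_matI)
  fix i j assume "i < dim_row (0\<^sub>m (dim_row A) (dim_col A))" "j < dim_col (0\<^sub>m (dim_row A) (dim_col A))"
  then have ij: "i < dim_row A" "j < dim_col A" by auto
  have "(\<Sum>i<dim_row A. \<Sum>j<dim_col A. A $$ (i, j) * A $$ (i, j)) = 0"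
    using assms by (simp add: fro_norm_square fro_inner_def)
  then have "\<forall>i<dim_row A. (\<Sum>j<dim_col A. A $$ (i, j) * A $$ (i, j)) = 0"
    by (subst (asm) sum_nonneg_eq_0_iff) (auto intro: sum_nonneg)
  then have "\<forall>i<dim_row A. \<forall>j<dim_col A. A $$ (i, j) * A $$ (i, j) = 0"
    by (subst (asm) sum_nonneg_eq_0_iff) auto
  then show "A $$ (i, j) = 0\<^sub>m (dim_row A) (dim_col A) $$ (i, j)" using ij by auto
qed auto

text \<open>Multiplication by the transpose is the adjoint of multiplication by \<open>A\<close>;
  both sides are the same triple sum in different orders.\<close>

lemma fro_inner_mult_left:
  assumes "dim_col A = dim_row D" "dim_row R = dim_row A" "dim_col R = dim_col D"
  shows "fro_inner (A * D) R = fro_inner D (transpose_mat A * R)"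
proof -
  have "fro_inner (A * D) R
      = (\<Sum>i<dim_row A. \<Sum>j<dim_col D. \<Sum>k<dim_row D. A $$ (i, k) * D $$ (k, j) * R $$ (i, j))"
    using assms by (simp add: fro_inner_def scalar_prod_def atLeast0LessThan sum_distrib_right)
  also have "\<dots> = (\<Sum>j<dim_col D. \<Sum>i<dim_row A. \<Sum>k<dim_row D. A $$ (i, k) * D $$ (k, j) * R $$ (i, j))"
    by (rule sum.swap)
  also have "\<dots> = (\<Sum>j<dim_col D. \<Sum>k<dim_row D. \<Sum>i<dim_row A. A $$ (i, k) * D $$ (k, j) * R $$ (i, j))"
    by (intro sum.cong[OF refl] sum.swap)
  also have "\<dots> = (\<Sum>k<dim_row D. \<Sum>j<dim_col D. \<Sum>i<dim_row A. A $$ (i, k) * D $$ (k, j) * R $$ (i, j))"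
    by (rule sum.swap)
  also have "\<dots> = fro_inner D (transpose_mat A * R)"
    using assms
    by (simp add: fro_inner_def scalar_prod_def atLeast0LessThan sum_distrib_left mult_ac)
  finally show ?thesis .
qed

lemma fro_inner_smult_right:
  assumes "dim_row B = dim_row A" "dim_col B = dim_col A"
  shows "fro_inner A (c \<cdot>\<^sub>m B) = c * fro_inner A B"
  using assms by (simp add: fro_inner_def sum_distrib_left mult_ac)

lemma fro_inner_add_right:
  assumes "dim_row B = dim_row A" "dim_col B = dim_col A" "dim_row C = dim_row A" "dim_col C = dim_col A"
  shows "fro_inner A (B + C) = fro_inner A B + fro_inner A C"
  using assms by (simp add: fro_inner_def sum.distrib algebra_simps)

lemma fro_norm_square_add:
  assumes "dim_row B = dim_row A" "dim_col B = dim_col A"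
  shows "(fro_norm (A + B))\<^sup>2 = (fro_norm A)\<^sup>2 + 2 * fro_inner B A + (fro_norm B)\<^sup>2"
  using assms by (simp add: fro_norm_square fro_inner_def sum.distrib sum_distrib_left algebra_simps)

lemma fro_norm_square_minus:
  assumes "dim_row B = dim_row A" "dim_col B = dim_col A"
  shows "(fro_norm (A - B))\<^sup>2 = (fro_norm A)\<^sup>2 - 2 * fro_inner B A + (fro_norm B)\<^sup>2"
  using assms
  by (simp add: fro_norm_square fro_inner_def sum.distrib sum_subtractf sum_distrib_left algebra_simps)

text \<open>Completing the square: the objective at \<open>W\<^sub>0 + D\<close> exceeds the one at \<open>W\<^sub>0\<close> by
  \<open>\<parallel>A D\<parallel>\<^sup>2 + c \<parallel>D\<parallel>\<^sup>2\<close>.\<close>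
lemma ridge_normal_equation_imp_arg_min:
  assumes Y: "dim_row Y = dim_row A"
    and W0: "W0 \<in> carrier_mat (dim_col A) (dim_col Y)" and c: "c \<ge> 0"
    and eq: "transpose_mat A * A * W0 + c \<cdot>\<^sub>m W0 = transpose_mat A * Y"
  shows "is_arg_min (\<lambda>W. (fro_norm (Y - A * W))\<^sup>2 + c * (fro_norm W)\<^sup>2)
    (\<lambda>W. W \<in> carrier_mat (dim_col A) (dim_col Y)) W0"
proof -
  have [simp]: "dim_row W0 = dim_col A" "dim_col W0 = dim_col Y" using W0 by auto
  define R where "R = Y - A * W0"
  have [simp]: "dim_row R = dim_row A" "dim_col R = dim_col Y" using Y by (auto simp: R_def)
  have "transpose_mat A * R = transpose_mat A * Y - transpose_mat A * A * W0"
    using Y by (simp add: R_def mat_mult_minus_dim mat_mult_assoc_dim)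
  also have "\<dots> = c \<cdot>\<^sub>m W0"
    unfolding eq[symmetric] by (intro eq_matI) auto
  finally have TR: "transpose_mat A * R = c \<cdot>\<^sub>m W0" .
  have "(fro_norm (Y - A * W0))\<^sup>2 + c * (fro_norm W0)\<^sup>2 \<le> (fro_norm (Y - A * W))\<^sup>2 + c * (fro_norm W)\<^sup>2"
    if W: "W \<in> carrier_mat (dim_col A) (dim_col Y)" for W
  proof -
    define D where "D = W - W0"
    have [simp]: "dim_row W = dim_col A" "dim_col W = dim_col Y" using W by auto
    have [simp]: "dim_row D = dim_col A" "dim_col D = dim_col Y" by (auto simp: D_def)
    have WD: "W = W0 + D" by (intro eq_matI) (auto simp: D_def)
    have "A * D = A * W - A * W0" by (simp add: D_def mat_mult_minus_dim)
    then have "Y - A * W = R - A * D" using Y by (intro eq_matI) (auto simp: R_def)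
    then have "(fro_norm (Y - A * W))\<^sup>2 = (fro_norm R)\<^sup>2 - 2 * fro_inner (A * D) R + (fro_norm (A * D))\<^sup>2"
      by (simp add: fro_norm_square_minus)
    \<comment> \<open>By \<open>TR\<close>, the cross term of the residual equals that of the
      penalty with opposite sign, so the two cancel and only squares remain.\<close>
    moreover have "fro_inner (A * D) R = c * fro_inner D W0"
      by (simp add: fro_inner_mult_left TR fro_inner_smult_right)
    moreover have "(fro_norm W)\<^sup>2 = (fro_norm W0)\<^sup>2 + 2 * fro_inner D W0 + (fro_norm D)\<^sup>2"
      unfolding WD by (simp add: fro_norm_square_add)
    moreover have "0 \<le> (fro_norm (A * D))\<^sup>2 + c * (fro_norm D)\<^sup>2" using c by simp
    ultimately show ?thesis unfolding R_def[symmetric] by (simp add: algebra_simps)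
  qed
  then show ?thesis using W0 by (auto simp: is_arg_min_def not_less)
qed

section \<open>Regularized covariances and local models\<close>

lemma dim_reg_cov [simp]: "dim_row (reg_cov \<gamma> X) = dim_col X" "dim_col (reg_cov \<gamma> X) = dim_col X"
  by (auto simp: reg_cov_def)

lemma reg_cov_mult:
  assumes "dim_row W = dim_col X"
  shows "reg_cov \<gamma> X * W = transpose_mat X * X * W + \<gamma> \<cdot>\<^sub>m W"
proof -
  have W: "W \<in> carrier_mat (dim_col X) (dim_col W)" using assms by auto
  have "reg_cov \<gamma> X * W = transpose_mat X * X * W + \<gamma> \<cdot>\<^sub>m 1\<^sub>m (dim_col X) * W"
    unfolding reg_cov_def
    by (rule add_mult_distrib_mat[of _ "dim_col X" "dim_col X" _ _ "dim_col W"]) (use assms in auto)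
  also have "\<gamma> \<cdot>\<^sub>m 1\<^sub>m (dim_col X) * W = \<gamma> \<cdot>\<^sub>m W"
    by (simp only: mult_smult_assoc_mat[OF one_carrier_mat W] left_mult_one_mat[OF W])
  finally show ?thesis .
qed

text \<open>Positive definiteness: pairing \<open>reg_cov \<gamma> X * N\<close> with
  \<open>N\<close> gives the squared norm of \<open>X * N\<close> plus \<open>\<gamma>\<close> times
  that of \<open>N\<close>.\<close>

lemma reg_cov_mult_eq_0:
  assumes "\<gamma> > 0" "dim_row N = dim_col X" "reg_cov \<gamma> X * N = 0\<^sub>m (dim_col X) (dim_col N)"
  shows "N = 0\<^sub>m (dim_col X) (dim_col N)"
proof -
  have "0 = fro_inner N (reg_cov \<gamma> X * N)"
    unfolding assms(3) using assms(2) by (simp add: fro_inner_def)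
  also have "\<dots> = fro_inner N (transpose_mat X * (X * N)) + \<gamma> * fro_inner N N"
    using assms(2)
    by (simp add: reg_cov_mult fro_inner_add_right fro_inner_smult_right mat_mult_assoc_dim)
  also have "\<dots> = (fro_norm (X * N))\<^sup>2 + \<gamma> * (fro_norm N)\<^sup>2"
    using assms(2) by (simp add: fro_inner_mult_left fro_norm_square)
  finally have "\<gamma> * (fro_norm N)\<^sup>2 \<le> 0" by (metis le_add_same_cancel2 zero_le_power2)
  then have "(fro_norm N)\<^sup>2 = 0" using \<open>\<gamma> > 0\<close>
    by (metis mult_le_cancel_left_pos mult_zero_right order_antisym zero_le_power2)
  from fro_norm_square_eq_0[OF this] show ?thesis using assms by simp
qed

text \<open>Trivial kernel upgrades an inner inverse to a left inverse, which for a square matrix is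
  two-sided. Hence \<open>mat_inverse\<close> does not return \<open>None\<close>, and
  \<open>mat_inv\<close> is a genuine inverse.\<close>

lemma mat_inv_reg_cov:
  assumes "\<gamma> > 0"
  shows "mat_inv (reg_cov \<gamma> X) \<in> carrier_mat (dim_col X) (dim_col X)"
    and "reg_cov \<gamma> X * mat_inv (reg_cov \<gamma> X) = 1\<^sub>m (dim_col X)"
proof -
  let ?M = "reg_cov \<gamma> X" let ?n = "dim_col X"
  have M: "?M \<in> carrier_mat ?n ?n" by auto
  obtain G where G: "G \<in> carrier_mat ?n ?n" and inner: "?M * G * ?M = ?M"
    using inner_inverse_exists[of ?M] by auto
  have [simp]: "dim_row G = ?n" "dim_col G = ?n" using G by auto
  have "?M * (G * ?M - 1\<^sub>m ?n) = ?M * G * ?M - ?M"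
    using right_mult_one_mat[OF M] by (simp add: mat_mult_minus_dim mat_mult_assoc_dim)
  then have "?M * (G * ?M - 1\<^sub>m ?n) = 0\<^sub>m ?n ?n" unfolding inner by (auto intro!: eq_matI)
  then have "G * ?M - 1\<^sub>m ?n = 0\<^sub>m ?n ?n"
    using reg_cov_mult_eq_0[OF assms, of "G * ?M - 1\<^sub>m ?n" X] by simp
  then have GM: "G * ?M = 1\<^sub>m ?n" using mat_minus_eq_0_iff[of "G * ?M" "1\<^sub>m ?n"] by simp
  then have "?M * G = 1\<^sub>m ?n" by (rule mat_mult_left_right_inverse[OF G M])
  with GM have "?M \<in> Units (ring_mat TYPE(real) ?n ())"
    using G M by (auto simp: Units_def ring_mat_simps)
  then obtain N where N: "mat_inverse ?M = Some N"
    using mat_inverse(1)[OF M, where b = "()"] by (cases "mat_inverse ?M") auto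
  with mat_inverse(2)[OF M N]
  show "mat_inv ?M \<in> carrier_mat ?n ?n" "?M * mat_inv ?M = 1\<^sub>m ?n"
    by (auto simp: mat_inv_def)
qed

lemma reg_cov_mult_mat_inv:
  assumes "\<gamma> > 0" "dim_row B = dim_col X"
  shows "reg_cov \<gamma> X * (mat_inv (reg_cov \<gamma> X) * B) = B"
proof -
  have "reg_cov \<gamma> X * (mat_inv (reg_cov \<gamma> X) * B) = reg_cov \<gamma> X * mat_inv (reg_cov \<gamma> X) * B"
    using mat_inv_reg_cov(1)[OF assms(1), of X] assms(2) by (subst mat_mult_assoc_dim) auto
  also have "\<dots> = B"
    unfolding mat_inv_reg_cov(2)[OF assms(1)] using assms(2) by simp
  finally show ?thesis .
qed

lemma local_model_carrier:
  assumes "\<gamma> > 0"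
  shows "local_model \<gamma> X Y \<in> carrier_mat (dim_col X) (dim_col Y)"
  using mat_inv_reg_cov(1)[OF assms, of X] by (auto simp: local_model_def)

lemma reg_cov_mult_local_model:
  assumes "\<gamma> > 0"
  shows "reg_cov \<gamma> X * local_model \<gamma> X Y = transpose_mat X * Y"
  unfolding local_model_def by (rule reg_cov_mult_mat_inv) (use assms in auto)

text \<open>Serves each client with its own \<open>\<gamma>\<close>, and also the stacked data with
  the total regularization, because the aggregate turns out to be the local model of the
  stack.\<close>

lemma local_model_arg_min:
  assumes "\<gamma> > 0" "dim_row Y = dim_row X"
  shows "is_arg_min (\<lambda>W. (fro_norm (Y - X * W))\<^sup>2 + \<gamma> * (fro_norm W)\<^sup>2)
    (\<lambda>W. W \<in> carrier_mat (dim_col X) (dim_col Y)) (local_model \<gamma> X Y)"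
proof (rule ridge_normal_equation_imp_arg_min[OF assms(2) local_model_carrier[OF assms(1)]])
  show "transpose_mat X * X * local_model \<gamma> X Y + \<gamma> \<cdot>\<^sub>m local_model \<gamma> X Y = transpose_mat X * Y"
    using reg_cov_mult_local_model[OF assms(1), of X Y] local_model_carrier[OF assms(1), of X Y]
    by (subst (asm) reg_cov_mult) auto
qed (use assms in simp)

section \<open>Stacked data and aggregation\<close>

lemma mat_sum_Nil [simp]: "mat_sum nr nc [] = 0\<^sub>m nr nc"
  and mat_sum_Cons [simp]: "mat_sum nr nc (A # As) = A + mat_sum nr nc As"
  by (simp_all add: mat_sum_def)

lemma dim_mat_sum [simp]: "dim_row (mat_sum nr nc As) = nr" "dim_col (mat_sum nr nc As) = nc"
  by (induction As) auto

lemma mult_mat_sum: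
  fixes A :: "real mat"
  assumes "dim_col A = nr" "\<And>M. M \<in> set Ms \<Longrightarrow> M \<in> carrier_mat nr nc"
  shows "A * mat_sum nr nc Ms = mat_sum (dim_row A) nc (map ((*) A) Ms)"
  using assms(2)
proof (induction Ms)
  case Nil
  have A: "A \<in> carrier_mat (dim_row A) nr" using assms(1) by auto
  show ?case by (simp only: mat_sum_Nil list.map right_mult_zero_mat[OF A])
next
  case (Cons M Ms)
  then have "A * (M + mat_sum nr nc Ms) = A * M + A * mat_sum nr nc Ms"
    using assms(1)
    by (intro mult_add_distrib_mat[of _ "dim_row A" nr _ nc]) (auto intro!: carrier_matI)
  with Cons show ?case by simp
qed

section \<open>Vertical stacks of client data\<close>

lemma dim_row_vstack_Nil [simp]: "dim_row (vstack nc []) = 0"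
  and dim_row_vstack_Cons [simp]: "dim_row (vstack nc (A # As)) = dim_row A + dim_row (vstack nc As)"
  and dim_col_vstack [simp]: "dim_col (vstack nc As) = nc"
  by (simp_all add: vstack_def)

lemma vstack_Cons_index:
  assumes "dim_col A = nc" "j < nc"
  shows "i < dim_row A \<Longrightarrow> vstack nc (A # As) $$ (i, j) = A $$ (i, j)"
    and "i < dim_row (vstack nc As) \<Longrightarrow>
      vstack nc (A # As) $$ (dim_row A + i, j) = vstack nc As $$ (i, j)"
  using assms by (auto simp: vstack_def mat_of_rows_index nth_append)

lemma row_vstack_Cons:
  assumes "dim_col A = nc"
  shows "i < dim_row A \<Longrightarrow> row (vstack nc (A # As)) i = row A i"
    and "i < dim_row (vstack nc As) \<Longrightarrow>
      row (vstack nc (A # As)) (dim_row A + i) = row (vstack nc As) i"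
  using assms by (auto intro!: eq_vecI simp: vstack_Cons_index)

lemma sum_lessThan_add:
  fixes n m :: nat
  shows "(\<Sum>k<n + m. f k) = (\<Sum>k<n. f k) + (\<Sum>k<m. f (n + k) :: 'a :: comm_monoid_add)"
  by (induction m) (auto simp: add_ac)

text \<open>Clients share the column counts, while row counts may vary from client to client and may
  be 0.\<close>

definition conformant :: "nat \<Rightarrow> nat \<Rightarrow> (real mat \<times> real mat) list \<Rightarrow> bool" where
  "conformant n c ds \<longleftrightarrow>
    (\<forall>(X, Y) \<in> set ds. dim_col X = n \<and> dim_col Y = c \<and> dim_row X = dim_row Y)"

lemma conformant_Nil [simp]: "conformant n c []"
  and conformant_Cons [simp]: "conformant n c ((X, Y) # ds) \<longleftrightarrow>
    dim_col X = n \<and> dim_col Y = c \<and> dim_row X = dim_row Y \<and> conformant n c ds"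
  by (auto simp: conformant_def)

lemma dim_row_vstack_eq:
  assumes "conformant n c ds"
  shows "dim_row (vstack n (map fst ds)) = dim_row (vstack c (map snd ds))"
  using assms by (induction ds) auto

text \<open>Each entry of the product is a sum over stacked rows, which splits at the block
  boundaries.\<close>

lemma transpose_vstack_mult_vstack:
  assumes "conformant n c ds"
  shows "transpose_mat (vstack n (map fst ds)) * vstack c (map snd ds)
    = mat_sum n c (map (\<lambda>(X, Y). transpose_mat X * Y) ds)"
  using assms
proof (induction ds)
  case Nil
  show ?case by (intro eq_matI) (auto simp: scalar_prod_def)
next
  case (Cons p ds)
  obtain X Y where p: "p = (X, Y)" by (cases p)
  have XY: "dim_col X = n" "dim_col Y = c" "dim_row Y = dim_row X"
    using Cons.prems p by auto
  have rows: "dim_row (vstack c (map snd ds)) = dim_row (vstack n (map fst ds))"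
    using Cons.prems p by (intro dim_row_vstack_eq[symmetric]) auto
  have IH: "transpose_mat (vstack n (map fst ds)) * vstack c (map snd ds)
    = mat_sum n c (map (\<lambda>(X, Y). transpose_mat X * Y) ds)"
    using Cons p by auto
  have "transpose_mat (vstack n (X # map fst ds)) * vstack c (Y # map snd ds)
    = transpose_mat X * Y + transpose_mat (vstack n (map fst ds)) * vstack c (map snd ds)"
  proof (rule eq_matI, goal_cases)
    case (1 i j)
    then show ?case
      using XY rows vstack_Cons_index[OF XY(1), of i] vstack_Cons_index[OF XY(2), of j]
      by (simp add: scalar_prod_def atLeast0LessThan sum_lessThan_add)
  qed (use XY in auto)
  then show ?case using IH p by simp
qed

lemma fro_norm_square_residual_vstack:
  assumes "conformant n c ds"
    and W: "W \<in> carrier_mat n c"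
  shows "(fro_norm (vstack c (map snd ds) - vstack n (map fst ds) * W))\<^sup>2
    = (\<Sum>(X, Y)\<leftarrow>ds. (fro_norm (Y - X * W))\<^sup>2)"
  using assms(1)
proof (induction ds)
  case Nil
  show ?case by (simp add: fro_norm_def)
next
  case (Cons p ds)
  obtain X Y where p: "p = (X, Y)" by (cases p)
  have XY: "dim_col X = n" "dim_col Y = c" "dim_row Y = dim_row X"
    using Cons.prems p by auto
  have rows: "dim_row (vstack c (map snd ds)) = dim_row (vstack n (map fst ds))"
    using Cons.prems p by (intro dim_row_vstack_eq[symmetric]) auto
  have IH: "(fro_norm (vstack c (map snd ds) - vstack n (map fst ds) * W))\<^sup>2
    = (\<Sum>(X, Y)\<leftarrow>ds. (fro_norm (Y - X * W))\<^sup>2)"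
    using Cons p by auto
  have "(fro_norm (vstack c (Y # map snd ds) - vstack n (X # map fst ds) * W))\<^sup>2
    = (fro_norm (Y - X * W))\<^sup>2 + (fro_norm (vstack c (map snd ds) - vstack n (map fst ds) * W))\<^sup>2"
    \<comment> \<open>Row \<open>i\<close> of a product with \<open>W\<close> depends only on row
      \<open>i\<close> of the left factor, so the residual of the stack is the stack of the
      residuals.\<close>
    using XY rows W vstack_Cons_index(1)[OF XY(2)] vstack_Cons_index(2)[OF XY(2)]
      row_vstack_Cons[OF XY(1)]
    by (simp add: fro_norm_square fro_inner_def sum_lessThan_add)
  then show ?case using IH p by simp
qed

section \<open>Server-side aggregation and removal of the regularization\<close>

text \<open>Every client adds its own multiple \<open>\<gamma>\<close> of the identity, so the
  transmitted covariances sum to that of the stack regularized by \<open>\<gamma>\<close> times the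
  number of clients.\<close>

lemma mat_sum_reg_cov:
  assumes "conformant n c ds"
  shows "mat_sum n n (map fst (map (client_message \<gamma>) ds))
    = reg_cov (real (length ds) * \<gamma>) (vstack n (map fst ds))"
proof -
  \<comment> \<open>Pairing each \<open>X\<close> with itself turns the Gram matrix into a case of
    the cross-term lemma for stacks.\<close>
  let ?gram = "\<lambda>ds. mat_sum n n (map (\<lambda>(X, Y). transpose_mat X * Y) (map (\<lambda>(X, Y). (X, X)) ds))"
  have "mat_sum n n (map fst (map (client_message \<gamma>) ds))
      = ?gram ds + (real (length ds) * \<gamma>) \<cdot>\<^sub>m 1\<^sub>m n"
    using assms
  proof (induction ds)
    case Nil
    show ?case by (intro eq_matI) auto
  next
    case (Cons p ds)
    obtain X Y where p: "p = (X, Y)" by (cases p)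
    have X: "dim_col X = n" using Cons.prems p by auto
    have "mat_sum n n (map fst (map (client_message \<gamma>) ds)) = ?gram ds + (real (length ds) * \<gamma>) \<cdot>\<^sub>m 1\<^sub>m n"
      using Cons p by auto
    then show ?case
      using X by (auto intro!: eq_matI simp: p client_message_def reg_cov_def algebra_simps)
  qed
  also have "?gram ds = transpose_mat (vstack n (map fst (map (\<lambda>(X, Y). (X, X)) ds)))
      * vstack n (map snd (map (\<lambda>(X, Y). (X, X)) ds))"
    by (rule transpose_vstack_mult_vstack[symmetric]) (use assms in \<open>auto simp: conformant_def\<close>)
  also have "map fst (map (\<lambda>(X, Y). (X, X)) ds) = map fst ds" by auto
  also have "map snd (map (\<lambda>(X, Y). (X, X)) ds) = map fst ds" by auto
  finally show ?thesis by (simp add: reg_cov_def)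
qed

text \<open>Since \<open>S\<^sub>k W\<^sub>k = X\<^sub>k\<^sup>T Y\<^sub>k\<close>, the weighted local models sum to the ridge solution of the stacked
  problem.\<close>
lemma aa_aggregate_client_messages:
  assumes "\<gamma> > 0" "ds \<noteq> []"
    and dims: "conformant n c ds"
  shows "aa_aggregate n c (map (client_message \<gamma>) ds)
    = local_model (real (length ds) * \<gamma>) (vstack n (map fst ds)) (vstack c (map snd ds))"
proof -
  let ?I = "mat_inv (reg_cov (real (length ds) * \<gamma>) (vstack n (map fst ds)))"
  \<comment> \<open>With at least one client the total regularization is positive, which makes the
    summed covariance invertible.\<close>
  have pos: "real (length ds) * \<gamma> > 0" using assms by simp
  have I: "?I \<in> carrier_mat n n" using mat_inv_reg_cov(1)[OF pos, of "vstack n (map fst ds)"] by simp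
  \<comment> \<open>The transmitted covariance undoes the local inverse, so each weighted model
    reduces to the common factor \<open>?I\<close> times the client's cross term.\<close>
  have summand: "?I * S * W = ?I * (transpose_mat X * Y)"
    if "(X, Y) \<in> set ds" "client_message \<gamma> (X, Y) = (S, W)" for X Y S W
  proof -
    have SW: "S = reg_cov \<gamma> X" "W = local_model \<gamma> X Y"
      using that by (auto simp: client_message_def)
    have "?I * S * W = ?I * (S * W)"
      using I dims that(1) local_model_carrier[OF assms(1), of X Y] SW
      by (intro mat_mult_assoc_dim) (auto simp: conformant_def)
    then show ?thesis using reg_cov_mult_local_model[OF assms(1)] SW by simp
  qed
  have "aa_aggregate n c (map (client_message \<gamma>) ds)
      = mat_sum n c (map (\<lambda>(S, W). ?I * S * W) (map (client_message \<gamma>) ds))"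
    by (simp only: aa_aggregate_def mat_sum_reg_cov[OF dims])
  also have "map (\<lambda>(S, W). ?I * S * W) (map (client_message \<gamma>) ds)
      = map ((*) ?I) (map (\<lambda>(X, Y). transpose_mat X * Y) ds)"
    using summand by (auto split: prod.splits)
  also have "mat_sum n c \<dots> = ?I * mat_sum n c (map (\<lambda>(X, Y). transpose_mat X * Y) ds)"
    using mult_mat_sum[of ?I n "map (\<lambda>(X, Y). transpose_mat X * Y) ds" c] I dims
    by (fastforce simp: conformant_def)
  also have "\<dots> = ?I * (transpose_mat (vstack n (map fst ds)) * vstack c (map snd ds))"
    by (subst transpose_vstack_mult_vstack[OF dims]) auto
  finally show ?thesis by (simp add: local_model_def)
qed

text \<open>The summed covariance times the aggregate is exactly the cross term of the stack, and
  subtracting the known regularization leaves exactly its Gram matrix. The result is therefore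
  independent of \<open>\<gamma>\<close>, whatever the rank of \<open>\<Phi>\<close>.\<close>

lemma ri_aa_server_client_messages:
  assumes "\<gamma> > 0" "ds \<noteq> []"
    and dims: "conformant n c ds"
    and \<Phi>: "\<Phi> = vstack n (map fst ds)" and Y: "Y = vstack c (map snd ds)"
  shows "ri_aa_server \<gamma> n c (map (client_message \<gamma>) ds)
    = pinv (transpose_mat \<Phi> * \<Phi>) * (transpose_mat \<Phi> * Y)"
proof -
  let ?g = "real (length ds) * \<gamma>"
  have pos: "?g > 0" using assms by simp
  have "reg_cov ?g \<Phi> - ?g \<cdot>\<^sub>m 1\<^sub>m n = transpose_mat \<Phi> * \<Phi>"
    by (auto intro!: eq_matI simp: reg_cov_def \<Phi>)
  then show ?thesis
    unfolding ri_aa_server_def ri_remove_def Let_def mat_sum_reg_cov[OF dims] length_map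
      aa_aggregate_client_messages[OF assms(1-2) dims] \<Phi>[symmetric] Y[symmetric]
      reg_cov_mult_local_model[OF pos] by simp
qed

section \<open>Single-round reconstruction of the global SAFLe model\<close>

theorem theorem1:
  fixes d L q E G C K V D\<^sub>e :: nat
    and B :: "nat \<Rightarrow> real \<Rightarrow> nat"
    and P :: "nat \<Rightarrow> nat"
    and data :: "nat \<Rightarrow> (real vec \<times> nat) list"
    and \<Phi>\<^sub>k Y\<^sub>k :: "nat \<Rightarrow> real mat"
    and \<Phi> Y W_global :: "real mat"
  assumes "d > 0" "L > 0" "q > 0" "E > 0" "G > 0" "K > 0"
    and "E * G = d * L"
    and "V = q ^ G" and "D\<^sub>e = E * V"
    and "\<And>l r. l < L \<Longrightarrow> B l r < q"
    and "P permutes {..<d * L}"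
    and "\<And>k x c. k < K \<Longrightarrow> (x, c) \<in> set (data k) \<Longrightarrow> x \<in> carrier_vec d \<and> c < C"
    and "\<And>k. k < K \<Longrightarrow> \<Phi>\<^sub>k k = feature_matrix L q E G B P (map fst (data k))"
    and "\<And>k. k < K \<Longrightarrow> Y\<^sub>k k = label_matrix C (map snd (data k))"
    and "\<Phi> = vstack D\<^sub>e (map \<Phi>\<^sub>k [0..<K])"
    and "Y = vstack C (map Y\<^sub>k [0..<K])"
    and "W_global = pinv (transpose_mat \<Phi> * \<Phi>) * (transpose_mat \<Phi> * Y)"
  shows "W_global \<in> carrier_mat D\<^sub>e C \<and>
    (\<forall>W \<in> carrier_mat D\<^sub>e C.
             (\<Sum>k<K. (fro_norm (Y\<^sub>k k - \<Phi>\<^sub>k k * W))\<^sup>2) = (fro_norm (Y - \<Phi> * W))\<^sup>2) \<and>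
    transpose_mat \<Phi> * \<Phi> * W_global = transpose_mat \<Phi> * Y \<and>
    is_arg_min (\<lambda>W. \<Sum>k<K. (fro_norm (Y\<^sub>k k - \<Phi>\<^sub>k k * W))\<^sup>2)
           (\<lambda>W. W \<in> carrier_mat D\<^sub>e C) W_global \<and>
    (\<forall>\<gamma> > 0. \<forall>k < K.
             is_arg_min (\<lambda>W. (fro_norm (Y\<^sub>k k - \<Phi>\<^sub>k k * W))\<^sup>2 + \<gamma> * (fro_norm W)\<^sup>2)
               (\<lambda>W. W \<in> carrier_mat D\<^sub>e C) (local_model \<gamma> (\<Phi>\<^sub>k k) (Y\<^sub>k k))) \<and>
    (\<forall>\<gamma> > 0.
             is_arg_min (\<lambda>W. (fro_norm (Y - \<Phi> * W))\<^sup>2 + real K * \<gamma> * (fro_norm W)\<^sup>2)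
               (\<lambda>W. W \<in> carrier_mat D\<^sub>e C)
               (single_round (client_message \<gamma>) (aa_aggregate D\<^sub>e C) (map (\<lambda>k. (\<Phi>\<^sub>k k, Y\<^sub>k k)) [0..<K]))) \<and>
    (\<forall>\<gamma> > 0.
             single_round (client_message \<gamma>) (ri_aa_server \<gamma> D\<^sub>e C) (map (\<lambda>k. (\<Phi>\<^sub>k k, Y\<^sub>k k)) [0..<K])
               = W_global)"
proof (intro conjI ballI allI impI)
  note \<Phi>_def = assms(15) and Y_def = assms(16) and W_def = assms(17)
  define ds where "ds = map (\<lambda>k. (\<Phi>\<^sub>k k, Y\<^sub>k k)) [0..<K]"
  have stack: "\<Phi> = vstack D\<^sub>e (map fst ds)" "Y = vstack C (map snd ds)"
    by (simp_all add: ds_def \<Phi>_def Y_def comp_def)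
  have len: "length ds = K" "ds \<noteq> []" using \<open>K > 0\<close> by (auto simp: ds_def)
  \<comment> \<open>Both matrices of a client have one row per data item, and
    \<open>E * q ^ G\<close> is \<open>D\<^sub>e\<close>.\<close>
  have dim_k: "dim_col (\<Phi>\<^sub>k k) = D\<^sub>e" "dim_col (Y\<^sub>k k) = C" "dim_row (Y\<^sub>k k) = dim_row (\<Phi>\<^sub>k k)"
    if "k < K" for k
    using assms(8,9,13,14) that by (simp_all add: feature_matrix_def label_matrix_def)
  have dims: "conformant D\<^sub>e C ds"
    using dim_k by (auto simp: ds_def conformant_def)
  have dim\<Phi>: "dim_col \<Phi> = D\<^sub>e" "dim_col Y = C" "dim_row Y = dim_row \<Phi>"
    using dim_row_vstack_eq[OF dims] dims by (auto simp: stack)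
  have pinv_dims: "pinv (transpose_mat \<Phi> * \<Phi>) \<in> carrier_mat D\<^sub>e D\<^sub>e"
    using is_pinv_pinv[of "transpose_mat \<Phi> * \<Phi>"] dim\<Phi> by (simp add: is_pinv_def)
  then show W: "W_global \<in> carrier_mat D\<^sub>e C" using dim\<Phi> by (auto simp: W_def)
  show split: "(\<Sum>k<K. (fro_norm (Y\<^sub>k k - \<Phi>\<^sub>k k * W))\<^sup>2) = (fro_norm (Y - \<Phi> * W))\<^sup>2"
    if "W \<in> carrier_mat D\<^sub>e C" for W
    using fro_norm_square_residual_vstack[OF dims that]
    by (simp add: stack ds_def comp_def interv_sum_list_conv_sum_set_nat atLeast0LessThan)
  show normal: "transpose_mat \<Phi> * \<Phi> * W_global = transpose_mat \<Phi> * Y"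
    unfolding W_def using dim\<Phi> by (intro pinv_gram_normal_equation)
  \<comment> \<open>The zero penalty casts the plain normal equation as the ridge equation with
    \<open>c = 0\<close>, so completing the square also covers the unregularized problem.\<close>
  have "transpose_mat \<Phi> * \<Phi> * W_global + 0 \<cdot>\<^sub>m W_global = transpose_mat \<Phi> * Y"
    unfolding normal using W dim\<Phi> by (intro eq_matI) auto
  from ridge_normal_equation_imp_arg_min[OF _ _ _ this] W dim\<Phi>
  have "is_arg_min (\<lambda>W. (fro_norm (Y - \<Phi> * W))\<^sup>2) (\<lambda>W. W \<in> carrier_mat D\<^sub>e C) W_global"
    by simp
  then show "is_arg_min (\<lambda>W. \<Sum>k<K. (fro_norm (Y\<^sub>k k - \<Phi>\<^sub>k k * W))\<^sup>2)
      (\<lambda>W. W \<in> carrier_mat D\<^sub>e C) W_global"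
    by (auto simp: is_arg_min_def split)
  fix \<gamma> :: real assume \<gamma>: "\<gamma> > 0"
  show "is_arg_min (\<lambda>W. (fro_norm (Y\<^sub>k k - \<Phi>\<^sub>k k * W))\<^sup>2 + \<gamma> * (fro_norm W)\<^sup>2)
      (\<lambda>W. W \<in> carrier_mat D\<^sub>e C) (local_model \<gamma> (\<Phi>\<^sub>k k) (Y\<^sub>k k))" if "k < K" for k
    using local_model_arg_min[OF \<gamma> dim_k(3)[OF that]] dim_k[OF that] by simp
  \<comment> \<open>The aggregate is the local model of the stack at regularization
    \<open>real K * \<gamma>\<close>, so the optimality of local models applies to it.\<close>
  have "real K * \<gamma> > 0" using \<gamma> \<open>K > 0\<close> by simp
  from local_model_arg_min[OF this dim\<Phi>(3)]
  show "is_arg_min (\<lambda>W. (fro_norm (Y - \<Phi> * W))\<^sup>2 + real K * \<gamma> * (fro_norm W)\<^sup>2)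
      (\<lambda>W. W \<in> carrier_mat D\<^sub>e C)
      (single_round (client_message \<gamma>) (aa_aggregate D\<^sub>e C) (map (\<lambda>k. (\<Phi>\<^sub>k k, Y\<^sub>k k)) [0..<K]))"
    unfolding single_round_def ds_def[symmetric] aa_aggregate_client_messages[OF \<gamma> len(2) dims]
      stack[symmetric] len(1) dim\<Phi> .
  show "single_round (client_message \<gamma>) (ri_aa_server \<gamma> D\<^sub>e C) (map (\<lambda>k. (\<Phi>\<^sub>k k, Y\<^sub>k k)) [0..<K])
      = W_global"
    unfolding single_round_def ds_def[symmetric] W_def
    by (rule ri_aa_server_client_messages[OF \<gamma> len(2) dims stack])
qed

end
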